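(* Let $\Delta(x)$ be the error term associated with the real sequence $\{a_n\}_{n\ge 1}$, and $A(s)$ its Mellin transform (together with its continuation), as defined in the context. Suppose there is a real number $\sigma_0$ such that the following hold. (i) There exists a real $t_0\neq 0$ such that $\lambda:=\limsup_{\sigma\searrow\sigma_0}(\sigma-\sigma_0)|A(\sigma+it_0)|>0$ (with $\lambda$ finite). (ii) $l_s:=\limsup_{\sigma\searrow\sigma_0}(\sigma-\sigma_0)A(\sigma)<\infty$ and $l_i:=\liminf_{\sigma\searrow\sigma_0}(\sigma-\sigma_0)A(\sigma)>-\infty$. (iii) $l_i+\lambda>0$ and $l_s-\lambda<0$. (iv) $A(s)$ can be analytically continued to a region containing the real half-line $\{\sigma\in\mathbb{R}:\sigma>\sigma_0\}$. Fix $\epsilon$ with $0<\epsilon<\min(\lambda+l_i,\lambda-l_s)$ and put $$\mathcal{A}_1=\{x\in[1,\infty):\Delta(x)>(l_i+\lambda-\epsilon)x^{\sigma_0}\},\qquad \mathcal{A}_2=\{x\in[1,\infty):\Delta(x)<(l_s-\lambda+\epsilon)x^{\sigma_0}\}.$$ Then for any real number $M>1$, $$\mathfrak{m}(\mathcal{A}_j\cap[M,\infty))>0\qquad\text{for } j=1,2.$$ Consequently $\Delta(x)=\Omega_\pm(x^{\sigma_0})$.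
   Context: Setting. $\{a_n\}_{n\ge1}$ is a sequence of real numbers with Dirichlet series $D(s)=\sum_{n\ge1}a_n n^{-s}$. There are real numbers $T_0>0$ and $0<\sigma_1<\sigma_2$ such that: $D(s)$ converges absolutely for $\Re(s)>\sigma_2$; $D(s)$ continues meromorphically to $\Re(s)>\sigma_1$ and is analytic on the segments $\{\sigma+it:\sigma_1\le\sigma\le\sigma_2,\ t=\pm T_0\}$ and $\{\sigma_1+it:-T_0\le t\le T_0\}$. Let $\mathcal{P}$ be the (finite) set of poles $\sigma+it$ of $D$ with $\sigma>\sigma_1$, $|t|<T_0$. The main term is $\mathcal{M}(x)=\sum_{\rho\in\mathcal{P}}\mathrm{Res}_{s=\rho}\big(D(s)x^s/s\big)$, and the error term is $\Delta(x)=\sum^*_{n\le x}a_n-\mathcal{M}(x)$, where $\sum^*_{n\le x}a_n=\sum_{n\le x}a_n$ if $x\notin\mathbb{N}$ and $\sum^*_{n\le x}a_n=\sum_{n<x}a_n+\frac12a_x$ if $x\in\mathbb{N}$. Mellin transform. $A(s)=\int_1^\infty \Delta(x)x^{-s-1}\,dx$, which converges absolutely in some right half-plane. The symbol $A(s)$ also denotes the meromorphic continuation of this function to a connected open set containing that half-plane, the half-line $\{\sigma>\sigma_0\}$, and the points $\sigma+it_0$ for $\sigma>\sigma_0$ close to $\sigma_0$. Notation. $\mathfrak{m}$ is Lebesgue measure on $\mathbb{R}$. $\Delta(x)=\Omega_\pm(x^{\sigma_0})$ means $\limsup_{x\to\infty}\Delta(x)/x^{\sigma_0}>0$ and $\l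iminf_{x\to\infty}\Delta(x)/x^{\sigma_0}<0$.
   Formalization: The connected open set to which A(s) is continued is also required to have connected intersection with the half-plane Re(s) > σ_0; otherwise A(σ+it_0) could be a different branch reached from the left of that line, and the claim fails. *)

theory Defs
  imports "HOL-Complex_Analysis.Complex_Analysis"
begin

text \<open>
  A real sequence is a function \<open>a :: nat \<Rightarrow> real\<close> of which only the values \<open>a n\<close> with
  \<open>n \<ge> 1\<close> are used. \<open>D\<close> stands for the Dirichlet series of \<open>a\<close> together with its continuation.
\<close>

definition dirichlet_setting ::
  "(nat \<Rightarrow> real) \<Rightarrow> (complex \<Rightarrow> complex) \<Rightarrow> real \<Rightarrow> real \<Rightarrow> real \<Rightarrow> bool" where
  "dirichlet_setting a D T\<^sub>0 \<sigma>\<^sub>1 \<sigma>\<^sub>2 \<longleftrightarrow>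
     0 < T\<^sub>0 \<and> 0 < \<sigma>\<^sub>1 \<and> \<sigma>\<^sub>1 < \<sigma>\<^sub>2 \<and>
     (\<forall>s. Re s > \<sigma>\<^sub>2 \<longrightarrow>
        summable (\<lambda>n. norm (complex_of_real (a (Suc n)) * of_nat (Suc n) powr (- s))) \<and>
        D s = (\<Sum>n. complex_of_real (a (Suc n)) * of_nat (Suc n) powr (- s))) \<and>
     D meromorphic_on {s. Re s > \<sigma>\<^sub>1} \<and>
     D analytic_on {Complex \<sigma> t | \<sigma> t. \<sigma>\<^sub>1 \<le> \<sigma> \<and> \<sigma> \<le> \<sigma>\<^sub>2 \<and> (t = T\<^sub>0 \<or> t = - T\<^sub>0)} \<and>
     D analytic_on {Complex \<sigma>\<^sub>1 t | t. - T\<^sub>0 \<le> t \<and> t \<le> T\<^sub>0}"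

definition dirichlet_poles :: "(complex \<Rightarrow> complex) \<Rightarrow> real \<Rightarrow> real \<Rightarrow> complex set" where
  "dirichlet_poles D T\<^sub>0 \<sigma>\<^sub>1 = {\<rho>. is_pole D \<rho> \<and> Re \<rho> > \<sigma>\<^sub>1 \<and> \<bar>Im \<rho>\<bar> < T\<^sub>0}"

text \<open>So that the sum over the poles below is never the default value of an infinite sum:\<close>

lemma finite_dirichlet_poles:
  assumes "dirichlet_setting a D T\<^sub>0 \<sigma>\<^sub>1 \<sigma>\<^sub>2"
  shows "finite (dirichlet_poles D T\<^sub>0 \<sigma>\<^sub>1)"
proof -
  let ?f = "\<lambda>s n. complex_of_real (a (Suc n)) * of_nat (Suc n) powr (- s)"
  have summ: "summable (\<lambda>n. norm (?f s n))" and D: "D s = (\<Sum>n. ?f s n)" if "Re s > \<sigma>\<^sub>2" for s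
    using assms that unfolding dirichlet_setting_def by blast+
  have Re_le: "Re \<rho> \<le> \<sigma>\<^sub>2" if pole: "is_pole D \<rho>" for \<rho>
  proof (rule ccontr)
    assume "\<not> Re \<rho> \<le> \<sigma>\<^sub>2"
    then obtain d where d: "\<sigma>\<^sub>2 < d" "d < Re \<rho>"
      using dense by (metis not_le)
    define B where "B = (\<Sum>n. norm (?f (of_real d) n))"
    have sd: "summable (\<lambda>n. norm (?f (of_real d) n))"
      using summ[of "of_real d"] d by simp
    have bound: "norm (D s) \<le> B" if s: "Re s > d" for s
    proof -
      have ss: "summable (\<lambda>n. norm (?f s n))"
        using summ s d by auto
      have le: "norm (?f s n) \<le> norm (?f (of_real d) n)" for n
      proof -
        have "norm (of_nat (Suc n) powr (- z) :: complex) = real (Suc n) powr (- Re z)" for z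
          by (subst norm_powr_real_powr) (auto simp del: of_nat_Suc)
        moreover have "real (Suc n) powr (- Re s) \<le> real (Suc n) powr (- d)"
          using s by (intro powr_mono) auto
        ultimately show ?thesis
          unfolding norm_mult by (intro mult_left_mono) (auto simp del: of_nat_Suc)
      qed
      have "norm (D s) \<le> (\<Sum>n. norm (?f s n))"
        using D[of s] s d summable_norm[OF ss] by auto
      also have "\<dots> \<le> B"
        unfolding B_def by (rule suminf_le[OF le ss sd])
      finally show ?thesis .
    qed
    have "eventually (\<lambda>s. norm (D s) \<ge> B + 1) (at \<rho>)"
      using filterlim_at_infinity_imp_norm_at_top[OF pole[unfolded is_pole_def]]
      by (simp add: filterlim_at_top)
    moreover have "eventually (\<lambda>s. Re s > d) (at \<rho>)"
    proof -
      have "(Re \<longlongrightarrow> Re \<rho>) (at \<rho>)"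
        by (intro tendsto_intros)
      then show ?thesis
        using d(2) by (rule order_tendstoD)
    qed
    ultimately have "eventually (\<lambda>s. False) (at \<rho>)"
      by eventually_elim (use bound in force)
    then show False
      by simp
  qed
  define K where "K = cbox (Complex \<sigma>\<^sub>1 (- T\<^sub>0)) (Complex \<sigma>\<^sub>2 T\<^sub>0)"
  have left: "D analytic_on {Complex \<sigma>\<^sub>1 t | t. - T\<^sub>0 \<le> t \<and> t \<le> T\<^sub>0}"
    and right: "D meromorphic_on {s. Re s > \<sigma>\<^sub>1}"
    using assms unfolding dirichlet_setting_def by blast+
  have "D meromorphic_on {Complex \<sigma>\<^sub>1 t | t. - T\<^sub>0 \<le> t \<and> t \<le> T\<^sub>0} \<union> {s. Re s > \<sigma>\<^sub>1}"
    by (intro meromorphic_on_Un analytic_on_imp_meromorphic_on left right)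
  moreover have "K \<subseteq> {Complex \<sigma>\<^sub>1 t | t. - T\<^sub>0 \<le> t \<and> t \<le> T\<^sub>0} \<union> {s. Re s > \<sigma>\<^sub>1}"
    by (auto simp: K_def in_cbox_complex_iff complex_eq_iff )
  ultimately have "D meromorphic_on K"
    by (rule meromorphic_on_subset)
  then have "finite (K \<inter> {s. \<not> D analytic_on {s}})"
    using sparse_in_compact_finite[OF meromorphic_on_imp_sparse_singularities]
    by (simp add: K_def)
  moreover have "dirichlet_poles D T\<^sub>0 \<sigma>\<^sub>1 \<subseteq> K \<inter> {s. \<not> D analytic_on {s}}"
    using Re_le by (force simp: dirichlet_poles_def K_def in_cbox_complex_iff
                          dest: analytic_at_imp_no_pole)
  ultimately show ?thesis
    by (rule finite_subset[rotated])
qed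

definition main_term :: "(complex \<Rightarrow> complex) \<Rightarrow> real \<Rightarrow> real \<Rightarrow> real \<Rightarrow> complex" where
  "main_term D T\<^sub>0 \<sigma>\<^sub>1 x =
     (\<Sum>\<rho>\<in>dirichlet_poles D T\<^sub>0 \<sigma>\<^sub>1. residue (\<lambda>s. D s * complex_of_real x powr s / s) \<rho>)"

definition starred_sum :: "(nat \<Rightarrow> real) \<Rightarrow> real \<Rightarrow> real" where
  "starred_sum a x =
     (if x \<in> \<nat> then (\<Sum>n | 1 \<le> n \<and> real n < x. a n) + a (nat \<lfloor>x\<rfloor>) / 2
      else (\<Sum>n | 1 \<le> n \<and> real n \<le> x. a n))"

text \<open>
  As \<open>a\<close> is real, the poles and residues of \<open>D\<close> come in conjugate pairs, so the main term is
  real for \<open>x > 0\<close>; \<^const>\<open>Re\<close> only changes its type.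
\<close>

definition error_term ::
  "(nat \<Rightarrow> real) \<Rightarrow> (complex \<Rightarrow> complex) \<Rightarrow> real \<Rightarrow> real \<Rightarrow> real \<Rightarrow> real" where
  "error_term a D T\<^sub>0 \<sigma>\<^sub>1 x = starred_sum a x - Re (main_term D T\<^sub>0 \<sigma>\<^sub>1 x)"

text \<open>
  \<open>A\<close> is the Mellin transform of \<open>f\<close> on some right half-plane of absolute convergence and its
  meromorphic continuation on \<open>U\<close>. Being nicely meromorphic (and not just meromorphic) excludes
  arbitrary values at isolated points; such points could accumulate at the boundary of \<open>U\<close> and
  would affect upper limits taken there.

  A connected \<open>U\<close> may leave a half-plane \<open>Re s > \<sigma>\<^sub>0\<close> and enter it again elsewhere, and \<open>A\<close> may
  then be a different branch there from the one obtained by continuation inside the half-plane.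
  Where this matters, \<open>U \<inter> {s. Re s > \<sigma>\<^sub>0}\<close> has to be required to be connected as well.
\<close>

definition mellin_continuation ::
  "(real \<Rightarrow> real) \<Rightarrow> (complex \<Rightarrow> complex) \<Rightarrow> complex set \<Rightarrow> bool" where
  "mellin_continuation f A U \<longleftrightarrow>
     open U \<and> connected U \<and> A nicely_meromorphic_on U \<and>
     (\<exists>c. {s. Re s > c} \<subseteq> U \<and>
        (\<forall>s. Re s > c \<longrightarrow>
           set_integrable lborel {1..} (\<lambda>x. complex_of_real (f x) * complex_of_real x powr (- s - 1)) \<and>
           A s = (LINT x:{1..}|lborel. complex_of_real (f x) * complex_of_real x powr (- s - 1))))"

definition Omega_pm :: "(real \<Rightarrow> real) \<Rightarrow> (real \<Rightarrow> real) \<Rightarrow> bool" where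
  "Omega_pm f g \<longleftrightarrow>
     Limsup at_top (\<lambda>x. ereal (f x / g x)) > 0 \<and> Liminf at_top (\<lambda>x. ereal (f x / g x)) < 0"

end

theory Submission
  imports Defs
begin

text \<open>
  If \<open>\<Delta> x \<le> C x powr \<sigma>\<^sub>0\<close> held for almost all \<open>x \<ge> M\<close>, then
  \<open>F s = \<integral> (C x powr \<sigma>\<^sub>0 - \<Delta> x) x powr (-s-1) dx = C / (s - \<sigma>\<^sub>0) - A s\<close> would be a Mellin transform with
  eventually nonnegative integrand that continues along the half-line \<open>{\<sigma>\<^sub>0<..}\<close>. By Landau's
  theorem the integral converges for \<open>Re s > \<sigma>\<^sub>0\<close>, so that \<open>\<bar>F (\<sigma> + it\<^sub>0)\<bar> \<le> F \<sigma> + O(1)\<close>.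
  Multiplying by \<open>\<sigma> - \<sigma>\<^sub>0\<close> and letting \<open>\<sigma>\<close> tend to \<open>\<sigma>\<^sub>0\<close> gives \<open>\<lambda> \<le> C - l\<^sub>i\<close>, which fails
  for \<open>C = l\<^sub>i + \<lambda> - \<epsilon>\<close>. The other half follows by passing to \<open>-\<Delta>\<close>.
\<close>

section \<open>Laplace integrals over a measure space and Landau's theorem\<close>

text \<open>With \<open>L = ln\<close> on Lebesgue measure over the ray from 1, and with the factor
  \<open>1 / x\<close> absorbed into \<open>f\<close>, this is a Mellin transform. \<open>N\<close>
  and \<open>L\<close> stay fixed while \<open>f\<close> ranges over \<open>\<Delta>\<close>, a
  power, their difference and truncations of it.\<close>

locale laplace_integral =
  fixes N :: "'a measure" and L f :: "'a \<Rightarrow> real"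
  assumes L_measurable [measurable]: "L \<in> borel_measurable N"
    and f_measurable [measurable]: "f \<in> borel_measurable N"
    and L_nonneg: "\<And>x. x \<in> space N \<Longrightarrow> 0 \<le> L x"
begin

text \<open>The modulus of \<open>exp (- (s * L x))\<close> depends on \<open>Re s\<close> only, so
  integrability at a real point is absolute convergence on the vertical line through it.\<close>

definition conv :: "real \<Rightarrow> bool" where
  "conv \<sigma> \<longleftrightarrow> integrable N (\<lambda>x. f x * exp (- (\<sigma> * L x)))"

definition F :: "complex \<Rightarrow> complex" where
  "F s = (\<integral>x. of_real (f x) * exp (- (s * of_real (L x))) \<partial>N)"

lemma conv_mono:
  assumes "conv \<sigma>" "\<sigma> \<le> \<tau>"
  shows "conv \<tau>"
  unfolding conv_def
proof (rule Bochner_Integration.integrable_bound[OF assms(1)[unfolded conv_def]])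
  show "AE x in N. norm (f x * exp (- (\<tau> * L x))) \<le> norm (f x * exp (- (\<sigma> * L x)))"
    using assms(2) L_nonneg by (auto simp: abs_mult intro!: AE_I2 mult_left_mono mult_right_mono)
qed measurable

lemma integrable_F:
  assumes "conv \<sigma>" "\<sigma> \<le> Re s"
  shows "integrable N (\<lambda>x. of_real (f x) * exp (- (s * of_real (L x))) :: complex)"
proof (rule Bochner_Integration.integrable_bound[OF conv_mono[OF assms, unfolded conv_def]])
  show "AE x in N. norm (of_real (f x) * exp (- (s * of_real (L x))) :: complex)
          \<le> norm (f x * exp (- (Re s * L x)))"
    by (auto simp: norm_mult abs_mult)
qed measurable

lemma F_of_real:
  assumes "conv \<sigma>"
  shows "F (of_real \<sigma>) = of_real (\<integral>x. f x * exp (- (\<sigma> * L x)) \<partial>N)"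
proof -
  have "F (of_real \<sigma>) = (\<integral>x. complex_of_real (f x * exp (- (\<sigma> * L x))) \<partial>N)"
    unfolding F_def by (simp flip: exp_of_real)
  then show ?thesis
    by (simp only: integral_complex_of_real)
qed

text \<open>Expand \<open>exp (h * L x)\<close> in powers of \<open>h\<close> and integrate
  termwise: the absolute values of the terms add up to
  \<open>\<bar>f x\<bar> * exp (- ((Re b - norm h) * L x))\<close>, which is integrable by
  hypothesis. Writing \<open>b - h\<close> for the point keeps signs out of the coefficients, so for
  real \<open>b\<close> they inherit nonnegativity from \<open>f\<close>.\<close>

lemma
  assumes "conv (Re b - norm h)"
  shows integrable_F_coeff:
      "integrable N (\<lambda>x. of_real (f x * L x ^ k / fact k) * exp (- (b * of_real (L x))) * h ^ k)"
    and F_power_series: "(\<lambda>k. (\<integral>x. of_real (f x * L x ^ k / fact k) * exp (- (b * of_real (L x))) \<partial>N) * h ^ k)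
           sums F (b - h)"
proof -
  define u where "u = (\<lambda>k x. of_real (f x * L x ^ k / fact k) * exp (- (b * of_real (L x))) * h ^ k)"
  define g where "g = (\<lambda>x. \<bar>f x\<bar> * exp (- ((Re b - norm h) * L x)))"
  have [measurable]: "u k \<in> borel_measurable N" for k
    unfolding u_def by measurable
  have int_g: "integrable N g"
    using integrable_norm[OF assms[unfolded conv_def]] by (simp add: g_def abs_mult)
  have norm_u: "norm (u k x) = \<bar>f x\<bar> * exp (- (Re b * L x)) * ((L x * norm h) ^ k / fact k)"
    if "x \<in> space N" for k x
    using L_nonneg[OF that] by (simp add: u_def norm_mult norm_power norm_divide power_mult_distrib)
  have exp_sums: "(\<lambda>k. (L x * norm h) ^ k / fact k) sums exp (L x * norm h)" for x
    using exp_converges[of "L x * norm h"] by (simp add: divide_inverse mult.commute)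
  have norm_sums: "(\<lambda>k. norm (u k x)) sums g x" if "x \<in> space N" for x
  proof -
    have "g x = \<bar>f x\<bar> * exp (- (Re b * L x)) * exp (L x * norm h)"
      by (simp add: g_def algebra_simps flip: exp_add)
    then show ?thesis
      using sums_mult[OF exp_sums[of x], of "\<bar>f x\<bar> * exp (- (Re b * L x))"] that
      by (simp add: norm_u)
  qed
  have partial: "(\<Sum>k<n. norm (u k x)) \<le> g x" if "x \<in> space N" for n x
    using norm_sums[OF that] sum_le_suminf[of "\<lambda>k. norm (u k x)" "{..<n}"] by (auto simp: sums_iff)
  have int_u: "integrable N (u k)" for k
  proof (rule Bochner_Integration.integrable_bound[OF int_g])
    have "norm (u k x) \<le> g x" if "x \<in> space N" for x
      using partial[OF that, of "Suc k"] sum_nonneg[of "{..<k}" "\<lambda>k. norm (u k x)"]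
      unfolding sum.lessThan_Suc by (smt (verit) norm_ge_zero)
    then show "AE x in N. norm (u k x) \<le> norm (g x)"
      by (intro AE_I2) (metis abs_ge_self order_trans real_norm_def)
  qed measurable
  from this[of k] show
    "integrable N (\<lambda>x. of_real (f x * L x ^ k / fact k) * exp (- (b * of_real (L x))) * h ^ k)"
    unfolding u_def .
  have AE_summable: "AE x in N. summable (\<lambda>k. norm (u k x))"
    using norm_sums by (intro AE_I2) (auto simp: sums_iff)
  have "summable (\<lambda>k. \<integral>x. norm (u k x) \<partial>N)"
  proof (rule summableI_nonneg_bounded)
    fix n
    have "(\<Sum>k<n. \<integral>x. norm (u k x) \<partial>N) = (\<integral>x. (\<Sum>k<n. norm (u k x)) \<partial>N)"
      using int_u by (subst Bochner_Integration.integral_sum) auto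
    also have "\<dots> \<le> integral\<^sup>L N g"
      using int_u int_g partial by (intro integral_mono) auto
    finally show "(\<Sum>k<n. \<integral>x. norm (u k x) \<partial>N) \<le> integral\<^sup>L N g" .
  qed auto
  from sums_integral[OF int_u AE_summable this]
  have "(\<lambda>k. \<integral>x. u k x \<partial>N) sums (\<integral>x. (\<Sum>k. u k x) \<partial>N)" .
  moreover have "(\<Sum>k. u k x) = of_real (f x) * exp (- ((b - h) * of_real (L x)))" for x
  proof -
    have "(\<lambda>k. of_real (f x) * exp (- (b * of_real (L x))) * ((of_real (L x) * h) ^ k /\<^sub>R fact k))
        sums (of_real (f x) * exp (- (b * of_real (L x))) * exp (of_real (L x) * h))"
      by (intro sums_mult exp_converges)
    also have "(\<lambda>k. of_real (f x) * exp (- (b * of_real (L x))) * ((of_real (L x) * h) ^ k /\<^sub>R fact k))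
        = (\<lambda>k. u k x)"
      by (auto simp: u_def power_mult_distrib scaleR_conv_of_real field_simps)
    finally show ?thesis
      by (simp add: sums_iff algebra_simps flip: exp_add)
  qed
  ultimately show "(\<lambda>k. (\<integral>x. of_real (f x * L x ^ k / fact k) * exp (- (b * of_real (L x))) \<partial>N) * h ^ k)
           sums F (b - h)"
    unfolding F_def by (simp add: u_def)
qed

text \<open>The disc of radius \<open>Re b - c\<close> about \<open>b\<close> stays in the
  half-plane and \<open>F\<close> is a power series on it; these discs cover the half-plane.\<close>

lemma F_holomorphic:
  assumes "\<And>\<sigma>. \<sigma> > c \<Longrightarrow> conv \<sigma>"
  shows "F holomorphic_on {s. Re s > c}"
proof -
  have "F holomorphic_on ball b (Re b - c)" for b
  proof (rule power_series_holomorphic)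
    fix w assume w: "w \<in> ball b (Re b - c)"
    let ?a = "\<lambda>k. (\<integral>x. of_real (f x * L x ^ k / fact k) * exp (- (b * of_real (L x))) \<partial>N)"
    have "(\<lambda>k. ?a k * (b - w) ^ k) sums F (b - (b - w))"
      using w by (intro F_power_series assms) (auto simp: dist_norm)
    also have "(\<lambda>k. ?a k * (b - w) ^ k) = (\<lambda>k. (- 1) ^ k * ?a k * (w - b) ^ k)"
      by (auto simp: power_minus[of "w - b" for w, symmetric] algebra_simps simp flip: power_mult_distrib)
    finally show "(\<lambda>k. (- 1) ^ k * ?a k * (w - b) ^ k) sums F w"
      by simp
  qed
  then have "F holomorphic_on (\<Union>b\<in>{s. Re s > c}. ball b (Re b - c))"
    by (intro holomorphic_on_UN_open) auto
  then show ?thesis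
    by (rule holomorphic_on_subset) auto
qed

text \<open>
  Landau's theorem. Suppose the abscissa of convergence \<open>m\<close> exceeds \<open>\<sigma>\<^sub>0\<close>. If \<open>H\<close> is holomorphic on the
  disc of radius \<open>\<delta>\<close> about \<open>m\<close>, then \<open>F\<close> extends to the disc of radius \<open>sqrt (1 + \<delta>\<^sup>2) > 1\<close> about
  \<open>m + 1\<close>, so its power series there converges at some point left of \<open>m\<close>. In terms of
  \<open>h = b - s\<close> the coefficients are nonnegative, and monotone convergence makes the integral converge
  at that point as well.
\<close>

lemma landau:
  assumes nonneg: "AE x in N. 0 \<le> f x"
    and c: "conv c"
    and V: "open V" "\<And>\<sigma>. \<sigma>\<^sub>0 < \<sigma> \<Longrightarrow> of_real \<sigma> \<in> V"
    and H: "H holomorphic_on V" "\<And>\<sigma>. c < \<sigma> \<Longrightarrow> H (of_real \<sigma>) = F (of_real \<sigma>)"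
    and \<sigma>: "\<sigma>\<^sub>0 < \<sigma>"
  shows "conv \<sigma>"
proof (rule ccontr)
  assume not_conv: "\<not> conv \<sigma>"
  \<comment> \<open>The condition \<open>\<sigma>\<^sub>0 < \<tau>\<close> bounds \<open>S\<close>
    below, so that \<open>Inf S\<close> is meaningful. As \<open>conv \<sigma>\<close> fails,
    \<open>m\<close> is at least \<open>\<sigma>\<close> and hence the true abscissa of
    convergence.\<close>
  define S where "S = {\<tau>. \<sigma>\<^sub>0 < \<tau> \<and> conv \<tau>}"
  define m where "m = Inf S"
  have "max c (\<sigma>\<^sub>0 + 1) \<in> S"
    using conv_mono[OF c] by (auto simp: S_def)
  then have "S \<noteq> {}"
    by blast
  have bdd: "bdd_below S"
    by (rule bdd_belowI[of _ \<sigma>\<^sub>0]) (auto simp: S_def)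
  have "\<sigma> \<le> m"
    unfolding m_def using \<open>S \<noteq> {}\<close> not_conv conv_mono
    by (intro cInf_greatest) (auto simp: S_def intro: linear le_cases)
  with \<sigma> have m: "\<sigma>\<^sub>0 < m"
    by simp
  have conv_m: "conv \<tau>" if "m < \<tau>" for \<tau>
    using that \<open>S \<noteq> {}\<close> bdd conv_mono unfolding m_def
    by (subst (asm) cInf_less_iff) (auto simp: S_def)
  have F_hol: "F holomorphic_on {s. m < Re s}"
    using conv_m by (rule F_holomorphic)
  obtain \<delta> where \<delta>: "0 < \<delta>" "ball (of_real m) \<delta> \<subseteq> V"
    using V m by (meson openE)
  have open_half: "open {s. m < Re s}"
    by (rule open_halfspace_Re_gt)
  \<comment> \<open>\<open>p\<close> lies on the ray where \<open>H\<close> and \<open>F\<close>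
    agree by hypothesis. \<open>T\<close> links it to the right half of the disc about
    \<open>m\<close>, so the component of \<open>p\<close> contains that half disc.\<close>
  define p where "p = max c m + 1"
  define T where "T = complex_of_real ` {m<..} \<union> (ball (of_real m) \<delta> \<inter> {s. m < Re s})"
  \<comment> \<open>\<open>F\<close> and \<open>H\<close> may differ on the other components of \<open>V \<inter> {s. m < Re s}\<close>.\<close>
  define C where "C = connected_component_set (V \<inter> {s. m < Re s}) (of_real p)"
  have "connected T"
    unfolding T_def
  proof (rule connected_Un)
    show "connected (complex_of_real ` {m<..})"
      by (intro connected_continuous_image continuous_intros) auto
    show "connected (ball (of_real m) \<delta> \<inter> {s. m < Re s})"
      by (intro convex_connected convex_Int convex_ball convex_halfspace_Re_gt)
    have "complex_of_real (m + \<delta> / 2) \<in> complex_of_real ` {m<..} \<inter> (ball (of_real m) \<delta> \<inter> {s. m < Re s})"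
      using \<delta>(1) by (auto simp: dist_norm simp del: of_real_add simp flip: of_real_diff)
    then show "complex_of_real ` {m<..} \<inter> (ball (of_real m) \<delta> \<inter> {s. m < Re s}) \<noteq> {}"
      by blast
  qed
  moreover have p_T: "of_real p \<in> T"
    unfolding T_def by (intro UnI1 imageI) (simp add: p_def)
  moreover have "T \<subseteq> V \<inter> {s. m < Re s}"
    using \<delta>(2) V(2) m by (auto simp: T_def)
  ultimately have "T \<subseteq> C"
    unfolding C_def by (simp add: connected_component_maximal)
  have "open C"
    unfolding C_def using V(1) open_half by (intro open_connected_component open_Int)
  have "connected C"
    unfolding C_def by simp
  have C_sub: "C \<subseteq> V \<inter> {s. m < Re s}"
    unfolding C_def by (rule connected_component_subset)
  have F_eq_H: "F z = H z" if "z \<in> C" for z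
  proof -
    have "F z - H z = 0"
    proof (rule analytic_continuation[of "\<lambda>z. F z - H z" C "complex_of_real ` {max c m<..}" "of_real p"])
      show "(\<lambda>z. F z - H z) holomorphic_on C"
        using C_sub by (intro holomorphic_on_diff holomorphic_on_subset[OF F_hol]
            holomorphic_on_subset[OF H(1)]) auto
      have "complex_of_real ` {max c m<..} \<subseteq> T"
        by (auto simp: T_def)
      then show "complex_of_real ` {max c m<..} \<subseteq> C" "of_real p \<in> C"
        using \<open>T \<subseteq> C\<close> p_T by auto
      show "complex_of_real p islimpt complex_of_real ` {max c m<..}"
        unfolding islimpt_approachable
      proof safe
        fix e :: real assume "0 < e"
        then show "\<exists>x'\<in>complex_of_real ` {max c m<..}. x' \<noteq> of_real p \<and> dist x' (of_real p) < e"
          by (intro bexI[of _ "of_real (p + e / 2)"] imageI)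
             (auto simp: dist_norm p_def simp del: of_real_add simp flip: of_real_diff)
      qed
    qed (use \<open>open C\<close> \<open>connected C\<close> that H(2) in auto)
    then show ?thesis
      by simp
  qed
  \<comment> \<open>The half-plane and the disc about \<open>m\<close> overlap inside
    \<open>T\<close>, where \<open>F\<close> and \<open>H\<close> agree, so the two pieces glue to a
    holomorphic function.\<close>
  define G where "G = (\<lambda>z. if m < Re z then F z else H z)"
  have "G holomorphic_on {s. m < Re s} \<union> ball (of_real m) \<delta>"
  proof (rule holomorphic_on_Un)
    show "G holomorphic_on {s. m < Re s}"
      by (rule holomorphic_transform[OF F_hol]) (auto simp: G_def)
    show "G holomorphic_on ball (of_real m) \<delta>"
      by (rule holomorphic_transform[OF holomorphic_on_subset[OF H(1) \<delta>(2)]])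
         (use F_eq_H \<open>T \<subseteq> C\<close> in \<open>auto simp: G_def T_def\<close>)
  qed (use open_half in auto)
  moreover
  define r where "r = sqrt (1 + \<delta>\<^sup>2)"
  define b where "b = m + 1"
  have "ball (of_real b) r \<subseteq> {s. m < Re s} \<union> ball (of_real m) \<delta>"
  proof
    fix z assume z: "z \<in> ball (complex_of_real b) r"
    have "(Re z - m - 1)\<^sup>2 + (Im z)\<^sup>2 < 1 + \<delta>\<^sup>2"
      using z power2_commute[of "1 + m" "Re z"]
      by (simp add: dist_norm cmod_def r_def b_def algebra_simps)
    \<comment> \<open>The term \<open>- 2 * (Re z - m)\<close> is nonnegative left of
      \<open>m\<close>; dropping it turns distance below \<open>r\<close> from \<open>b\<close> into
      distance below \<open>\<delta>\<close> from \<open>m\<close>.\<close>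
    moreover have "(Re z - m - 1)\<^sup>2 = (Re z - m)\<^sup>2 + 1 - 2 * (Re z - m)"
      by (simp add: power2_eq_square algebra_simps)
    ultimately have "Re z \<le> m \<Longrightarrow> (Re z - m)\<^sup>2 + (Im z)\<^sup>2 < \<delta>\<^sup>2"
      by simp
    then have "Re z \<le> m \<Longrightarrow> cmod (z - of_real m) < \<delta>"
      using \<delta>(1) by (simp add: cmod_def real_less_lsqrt)
    then show "z \<in> {s. m < Re s} \<union> ball (of_real m) \<delta>"
      by (cases "Re z \<le> m") (auto simp: dist_norm norm_minus_commute[of "of_real m"])
  qed
  ultimately have G_hol: "G holomorphic_on ball (of_real b) r"
    by (rule holomorphic_on_subset)
  have r: "1 < r"
    using \<delta>(1) by (simp add: r_def)
  \<comment> \<open>\<open>e\<close> holds the Taylor coefficients of \<open>G\<close> at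
    \<open>b\<close>, with signs because the variable is \<open>h = b - z\<close>; \<open>d\<close>
    holds the same coefficients as integrals. The first series converges up to radius
    \<open>r\<close>, the second is so far tied to \<open>G\<close> only up to radius 1; uniqueness
    of expansions identifies them.\<close>
  define e where "e = (\<lambda>k. (- 1) ^ k * ((deriv ^^ k) G (of_real b) / fact k))"
  define d where "d = (\<lambda>k. \<integral>x. f x * L x ^ k / fact k * exp (- (b * L x)) \<partial>N)"
  have G_sums: "(\<lambda>k. e k * h ^ k) sums G (of_real b - h)" if "norm h < r" for h
  proof -
    have "(\<lambda>k. (deriv ^^ k) G (of_real b) / fact k * ((of_real b - h) - of_real b) ^ k)
             sums G (of_real b - h)"
      by (rule holomorphic_power_series[OF G_hol]) (use that in \<open>simp add: dist_norm\<close>)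
    then show ?thesis
      by (simp add: e_def power_minus[of h] algebra_simps)
  qed
  have coeff_eq: "complex_of_real (f x * L x ^ k / fact k) * exp (- (of_real b * of_real (L x)))
      = of_real (f x * L x ^ k / fact k * exp (- (b * L x)))" for k x
    by (simp flip: exp_of_real)
  have F_sums: "(\<lambda>k. of_real (d k) * h ^ k) sums G (of_real b - h)" if "norm h < 1" for h
  proof -
    have "m < Re (of_real b - h)"
      using that abs_Re_le_cmod[of h] by (simp add: b_def)
    moreover have "conv (Re (of_real b) - norm h)"
      using that by (intro conv_m) (simp add: b_def)
    note F_power_series[OF this, unfolded coeff_eq integral_complex_of_real]
    ultimately show ?thesis
      unfolding d_def G_def by simp
  qed
  have "(\<lambda>h. G (of_real b - h)) has_fps_expansion Abs_fps e"
    using r G_sums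
    by (intro has_fps_expansionI) (auto intro!: eventually_nhds_in_open[THEN eventually_mono, of "ball 0 1"])
  moreover have "(\<lambda>h. G (of_real b - h)) has_fps_expansion Abs_fps (\<lambda>k. of_real (d k))"
    using F_sums
    by (intro has_fps_expansionI) (auto intro!: eventually_nhds_in_open[THEN eventually_mono, of "ball 0 1"])
  ultimately have "Abs_fps e = Abs_fps (\<lambda>k. complex_of_real (d k))"
    by (rule fps_expansion_unique_complex)
  then have e_eq: "e = (\<lambda>k. of_real (d k))"
    by (metis fps_nth_Abs_fps ext)
  \<comment> \<open>\<open>1 < h\<close> puts \<open>b - h\<close> left of \<open>m\<close>, and
    \<open>h < m + 1 - \<sigma>\<^sub>0\<close> keeps it right of \<open>\<sigma>\<^sub>0\<close>,
    so \<open>conv (b - h)\<close> will contradict the choice of \<open>m\<close>.\<close>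
  obtain h where h: "1 < h" "h < min r (m + 1 - \<sigma>\<^sub>0)"
    using r m dense[of 1 "min r (m + 1 - \<sigma>\<^sub>0)"] by auto
  define u where "u = (\<lambda>k x. f x * L x ^ k / fact k * exp (- (b * L x)) * h ^ k)"
  have int_u: "integrable N (u k)" for k
  proof -
    \<comment> \<open>Convergence at \<open>b - h\<close> is still the goal, so integrability of the
      coefficient is taken at radius \<open>1 / 2\<close>, inside the known disc, and
      rescaled.\<close>
    have "conv (Re (of_real b) - norm (1 / 2 :: complex))"
      by (intro conv_m) (simp add: b_def)
    note integrable_F_coeff[OF this, of k, unfolded coeff_eq]
    then have "integrable N (\<lambda>x. complex_of_real (f x * L x ^ k / fact k * exp (- (b * L x)))
        * (1 / 2) ^ k * 2 ^ k)"
      by (rule integrable_mult_left)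
    moreover have "z * (1 / 2) ^ k * 2 ^ k = z" for z :: complex
      by (simp add: power_divide)
    ultimately have "integrable N (\<lambda>x. complex_of_real (f x * L x ^ k / fact k * exp (- (b * L x))))"
      by (simp only:)
    then have "integrable N (\<lambda>x. f x * L x ^ k / fact k * exp (- (b * L x)))"
      by (subst (asm) complex_of_real_integrable_eq)
    then show ?thesis
      unfolding u_def by (rule integrable_mult_left)
  qed
  \<comment> \<open>Nonnegativity turns the integral of \<open>norm (u k x)\<close> into
    \<open>d k * h ^ k\<close>, which is summable because the series of \<open>G\<close> converges
    at \<open>h < r\<close>.\<close>
  have u_nonneg: "AE x in N. norm (u k x) = u k x" for k
    using nonneg AE_space by eventually_elim (use h L_nonneg in \<open>auto simp: u_def\<close>)
  have "summable (\<lambda>k. e k * of_real h ^ k)"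
    using G_sums[of "of_real h"] h by (auto simp: sums_iff)
  then have "summable (\<lambda>k. complex_of_real (d k * h ^ k))"
    by (simp add: e_eq)
  then have "summable (\<lambda>k. d k * h ^ k)"
    by (simp only: summable_of_real_iff)
  moreover have "(\<integral>x. norm (u k x) \<partial>N) = d k * h ^ k" for k
  proof -
    have "(\<integral>x. norm (u k x) \<partial>N) = (\<integral>x. u k x \<partial>N)"
      using u_nonneg by (intro integral_cong_AE) (auto simp: u_def)
    then show ?thesis
      by (simp add: u_def d_def)
  qed
  ultimately have sum_int: "summable (\<lambda>k. \<integral>x. norm (u k x) \<partial>N)"
    by simp
  have u_sums: "(\<lambda>k. u k x) sums (f x * exp (- ((b - h) * L x)))" for x
  proof -
    have "(\<lambda>k. f x * exp (- (b * L x)) * ((L x * h) ^ k /\<^sub>R fact k))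
        sums (f x * exp (- (b * L x)) * exp (L x * h))"
      by (intro sums_mult exp_converges)
    also have "(\<lambda>k. f x * exp (- (b * L x)) * ((L x * h) ^ k /\<^sub>R fact k)) = (\<lambda>k. u k x)"
      by (auto simp: u_def power_mult_distrib field_simps)
    finally show ?thesis
      by (simp add: algebra_simps flip: exp_add)
  qed
  have "AE x in N. \<forall>k. norm (u k x) = u k x"
    using u_nonneg by (simp add: AE_all_countable)
  then have "AE x in N. summable (\<lambda>k. norm (u k x))"
    by eventually_elim (use u_sums in \<open>auto simp: sums_iff\<close>)
  from integrable_suminf[OF int_u this sum_int]
  have "conv (b - h)"
    using u_sums by (simp add: conv_def sums_iff)
  then have "b - h \<in> S"
    using h by (simp add: S_def b_def)
  then have "m \<le> b - h"
    unfolding m_def using bdd by (rule cInf_lower)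
  then show False
    using h by (simp add: b_def)
qed

lemma norm_F_le:
  assumes "conv \<tau>" "\<tau> \<le> Re s"
  shows "norm (F s) \<le> (\<integral>x. \<bar>f x\<bar> * exp (- (\<tau> * L x)) \<partial>N)"
  unfolding F_def
proof (rule order_trans[OF integral_norm_bound integral_mono])
  show "integrable N (\<lambda>x. norm (of_real (f x) * exp (- (s * of_real (L x))) :: complex))"
    using integrable_F[OF assms] by (rule integrable_norm)
  show "integrable N (\<lambda>x. \<bar>f x\<bar> * exp (- (\<tau> * L x)))"
    using integrable_norm[OF assms(1)[unfolded conv_def]] by (simp add: abs_mult)
  fix x assume "x \<in> space N"
  then show "norm (of_real (f x) * exp (- (s * of_real (L x))) :: complex) \<le> \<bar>f x\<bar> * exp (- (\<tau> * L x))"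
    using assms(2) L_nonneg by (auto simp: norm_mult intro!: mult_left_mono mult_right_mono)
qed

text \<open>Split \<open>f\<close> at \<open>L x = K\<close>. The lower part converges at every
  exponent, so its transform is entire and can be subtracted from \<open>H\<close>; Landau's theorem
  applies to the upper part. The upper part satisfies the final bound without error term by
  nonnegativity, and the lower part adds a bounded error.\<close>

lemma landau_eventually_nonneg:
  assumes nonneg: "AE x in N. K < L x \<longrightarrow> 0 \<le> f x"
    and c: "conv c"
    and V: "open V" "\<And>\<sigma>. \<sigma>\<^sub>0 < \<sigma> \<Longrightarrow> of_real \<sigma> \<in> V"
    and H: "H holomorphic_on V" "\<And>\<sigma>. c < \<sigma> \<Longrightarrow> H (of_real \<sigma>) = F (of_real \<sigma>)"
  shows "\<sigma>\<^sub>0 < \<sigma> \<Longrightarrow> conv \<sigma>"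
    and "\<exists>B. \<forall>s. \<sigma>\<^sub>0 < Re s \<longrightarrow> norm (F s) \<le> Re (F (of_real (Re s))) + B"
proof -
  define g h where "g = (\<lambda>x. if K < L x then f x else 0)" and "h = (\<lambda>x. if K < L x then 0 else f x)"
  interpret g: laplace_integral N L g
    by unfold_locales (auto simp: g_def L_nonneg)
  interpret h: laplace_integral N L h
    by unfold_locales (auto simp: h_def L_nonneg)
  have f_eq: "f x = g x + h x" for x
    by (simp add: g_def h_def)
  have g_c: "g.conv c"
    unfolding g.conv_def
    by (rule Bochner_Integration.integrable_bound[OF c[unfolded conv_def]]) (auto simp: g_def)
  have h_conv: "h.conv \<tau>" for \<tau>
    unfolding h.conv_def
  proof (rule Bochner_Integration.integrable_bound)
    show "integrable N (\<lambda>x. exp (\<bar>c - \<tau>\<bar> * \<bar>K\<bar>) * (f x * exp (- (c * L x))))"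
      using c[unfolded conv_def] by simp
    \<comment> \<open>The constant bounds \<open>exp ((c - \<tau>) * L x)\<close> uniformly over
      \<open>0 \<le> L x \<le> K\<close>.\<close>
    have "exp (- (\<tau> * L x)) \<le> exp (\<bar>c - \<tau>\<bar> * \<bar>K\<bar>) * exp (- (c * L x))"
      if "x \<in> space N" "L x \<le> K" for x
    proof -
      have "(c - \<tau>) * L x \<le> \<bar>c - \<tau>\<bar> * \<bar>K\<bar>"
        using that L_nonneg[of x] by (intro mult_mono) auto
      then show ?thesis
        by (simp add: algebra_simps flip: exp_add)
    qed
    then show "AE x in N. norm (h x * exp (- (\<tau> * L x)))
        \<le> norm (exp (\<bar>c - \<tau>\<bar> * \<bar>K\<bar>) * (f x * exp (- (c * L x))))"
      by (auto simp: h_def abs_mult mult.left_commute intro!: AE_I2 mult_left_mono)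
  qed measurable
  have F_split: "F s = g.F s + h.F s" if "g.conv (Re s)" for s
    unfolding F_def g.F_def h.F_def f_eq
    using g.integrable_F[OF that order_refl] h.integrable_F[OF h_conv order_refl]
    by (simp add: distrib_right flip: Bochner_Integration.integral_add)
  have g_conv: "g.conv \<sigma>" if "\<sigma>\<^sub>0 < \<sigma>" for \<sigma>
  proof (rule g.landau[OF _ g_c _ _ _ _ that])
    show "AE x in N. 0 \<le> g x"
      using nonneg by eventually_elim (auto simp: g_def)
    show "open (V \<inter> {s. \<sigma>\<^sub>0 < Re s})"
      using V(1) by (intro open_Int open_halfspace_Re_gt)
    show "of_real \<tau> \<in> V \<inter> {s. \<sigma>\<^sub>0 < Re s}" if "\<sigma>\<^sub>0 < \<tau>" for \<tau>
      using V(2) that by simp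
    show "(\<lambda>s. H s - h.F s) holomorphic_on V \<inter> {s. \<sigma>\<^sub>0 < Re s}"
      by (intro holomorphic_on_diff holomorphic_on_subset[OF H(1)]
          holomorphic_on_subset[OF h.F_holomorphic[OF h_conv]]) auto
    show "H (of_real \<tau>) - h.F (of_real \<tau>) = g.F (of_real \<tau>)" if "c < \<tau>" for \<tau>
      using H(2)[OF that] F_split[of "of_real \<tau>"] g.conv_mono[OF g_c, of \<tau>] that by simp
  qed
  show "conv \<sigma>" if "\<sigma>\<^sub>0 < \<sigma>" for \<sigma>
    using g_conv[OF that] h_conv[of \<sigma>] unfolding conv_def g.conv_def h.conv_def f_eq distrib_right
    by (rule Bochner_Integration.integrable_add)
  \<comment> \<open>Taken at the boundary \<open>\<sigma>\<^sub>0\<close>, this bounds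
    \<open>h.F\<close> uniformly to its right. It is used twice, at \<open>s\<close> and at
    \<open>Re s\<close>, whence \<open>2 * C\<close> below.\<close>
  define C where "C = (\<integral>x. \<bar>h x\<bar> * exp (- (\<sigma>\<^sub>0 * L x)) \<partial>N)"
  have "norm (F s) \<le> Re (F (of_real (Re s))) + 2 * C" if s: "\<sigma>\<^sub>0 < Re s" for s
  proof -
    have gs: "g.conv (Re s)" "g.conv (Re (complex_of_real (Re s)))"
      using g_conv[OF s] by simp_all
    have "norm (g.F s) \<le> (\<integral>x. \<bar>g x\<bar> * exp (- (Re s * L x)) \<partial>N)"
      by (rule g.norm_F_le[OF gs(1)]) simp
    also have "\<dots> = (\<integral>x. g x * exp (- (Re s * L x)) \<partial>N)"
    proof (rule integral_cong_AE)
      show "AE x in N. \<bar>g x\<bar> * exp (- (Re s * L x)) = g x * exp (- (Re s * L x))"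
        using nonneg by eventually_elim (auto simp: g_def)
    qed measurable
    also have "\<dots> = Re (g.F (of_real (Re s)))"
      by (simp add: g.F_of_real[OF gs(1)])
    finally have "norm (g.F s) \<le> Re (g.F (of_real (Re s)))" .
    moreover have "norm (h.F s) \<le> C" "norm (h.F (of_real (Re s))) \<le> C"
      unfolding C_def using s by (auto intro!: h.norm_F_le[OF h_conv])
    moreover note abs_Re_le_cmod[of "h.F (of_real (Re s))"] norm_triangle_ineq[of "g.F s" "h.F s"]
    ultimately show ?thesis
      using F_split[OF gs(1)] F_split[OF gs(2)] by simp
  qed
  then show "\<exists>B. \<forall>s. \<sigma>\<^sub>0 < Re s \<longrightarrow> norm (F s) \<le> Re (F (of_real (Re s))) + B"
    by blast
qed

end

section \<open>Identity theorem for nicely meromorphic functions\<close>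

text \<open>Off a sparse set the difference either vanishes or avoids 0, and \<open>T\<close> rules
  out the latter. At a remaining point \<open>A\<close> tends to the finite value
  \<open>Q z\<close>, so there is no pole, and nice meromorphy makes the value equal the
  limit.\<close>

lemma nicely_meromorphic_eq_holomorphic:
  assumes A: "A nicely_meromorphic_on S" and Q: "Q holomorphic_on S"
    and S: "open S" "connected S"
    and T: "open T" "T \<subseteq> S" "T \<noteq> {}" "\<And>z. z \<in> T \<Longrightarrow> A z = Q z"
    and z: "z \<in> S"
  shows "A z = Q z"
proof -
  let ?D = "\<lambda>z. A z - Q z"
  have mero: "?D meromorphic_on S"
  proof (rule meromorphic_on_diff)
    show "A meromorphic_on S"
      using A by (simp add: nicely_meromorphic_on_def)
    show "Q meromorphic_on S"
      using Q S(1) by (intro analytic_on_imp_meromorphic_on) (simp add: analytic_on_open)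
  qed
  have ev: "eventually (\<lambda>z. ?D z = 0) (cosparse S)"
  proof (rule disjE[OF meromorphic_imp_constant_or_avoid[OF mero S, of 0]])
    assume *: "eventually (\<lambda>z. ?D z \<noteq> 0) (cosparse S)"
    obtain t where t: "t \<in> T"
      using T by blast
    then have "eventually (\<lambda>z. ?D z \<noteq> 0) (at t)"
      using * T(2) by (auto simp: eventually_cosparse_open_eq S(1))
    moreover have "eventually (\<lambda>z. z \<in> T) (at t)"
      using T(1) t by (rule eventually_at_in_open')
    ultimately have "eventually (\<lambda>_. False) (at t)"
      by eventually_elim (use T(4) in auto)
    then show ?thesis
      by simp
  qed
  then have ev: "eventually (\<lambda>w. A w = Q w) (at z)"
    using z by (simp add: eventually_cosparse_open_eq S(1))
  have Q_lim: "Q \<midarrow>z\<rightarrow> Q z"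
    using Q S(1) z by (metis holomorphic_on_imp_continuous_on continuous_on_eq_continuous_at isCont_def)
  then have A_lim: "A \<midarrow>z\<rightarrow> Q z"
    using ev by (subst tendsto_cong) 
  moreover have "\<not> is_pole A z"
    using not_tendsto_and_filterlim_at_infinity[OF _ A_lim] by (auto simp: is_pole_def)
  then have "A \<midarrow>z\<rightarrow> A z"
    using A z by (auto simp: nicely_meromorphic_on_def)
  ultimately show ?thesis
    using LIM_unique by blast
qed

section \<open>Powers and the Mellin kernel on the ray from 1\<close>

lemma
  assumes "e < - 1"
  shows integrable_powr_to_inf: "integrable (restrict_space lborel {1..}) (\<lambda>x::real. x powr e)"
    and integral_powr_to_inf: "(\<integral>x. x powr e \<partial>restrict_space lborel {1..}) = - 1 / (e + 1)"
proof -
  note powr = has_integral_powr_to_inf[OF assms, of 1]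
  have abs_int: "(\<lambda>x. x powr e) absolutely_integrable_on {1..}"
    using powr by (intro nonnegative_absolutely_integrable_1) (auto simp: has_integral_integrable)
  then have "integrable lebesgue (\<lambda>x. indicator {1..} x *\<^sub>R x powr e)"
    by (simp add: set_integrable_def)
  then show "integrable (restrict_space lborel {1..}) (\<lambda>x::real. x powr e)"
    by (subst (asm) integrable_completion) (auto simp: integrable_restrict_space)
  have "(LINT x:{1..}|lebesgue. x powr e) = - 1 / (e + 1)"
    using set_lebesgue_integral_eq_integral(2)[OF abs_int] powr by (auto simp: integral_unique)
  then show "(\<integral>x. x powr e \<partial>restrict_space lborel {1..}) = - 1 / (e + 1)"
    unfolding set_lebesgue_integral_def
    by (subst (asm) integral_completion) (auto simp: integral_restrict_space)
qed

lemma mellin_kernel: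
  assumes "1 \<le> x"
  shows "complex_of_real x powr (- s - 1) = exp (- (s * of_real (ln x))) / of_real x"
  using assms by (simp add: powr_def Ln_of_real exp_diff ring_distribs exp_of_real)

section \<open>Positive measure of the set above a power\<close>

text \<open>An arbitrary \<open>\<Delta>\<close> lets the lemma serve both signs. \<open>p\<close>
  and \<open>q\<close> replace the upper and the lower limit: a frequent bound and an eventual bound
  hold together at some \<open>\<sigma>\<close> arbitrarily close to
  \<open>\<sigma>\<^sub>0\<close>.\<close>

lemma emeasure_above_power_pos:
  assumes mellin: "mellin_continuation \<Delta> A U"
    and U_right: "connected (U \<inter> {s. Re s > \<sigma>\<^sub>0})"
    and U_half_line: "\<And>\<sigma>. \<sigma> > \<sigma>\<^sub>0 \<Longrightarrow> complex_of_real \<sigma> \<in> U"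
    and U_t0: "\<forall>\<^sub>F \<sigma> in at_right \<sigma>\<^sub>0. Complex \<sigma> t\<^sub>0 \<in> U"
    and V: "open V" "complex_of_real ` {\<sigma>\<^sub>0<..} \<subseteq> V" "A holomorphic_on V"
    and t0: "t\<^sub>0 \<noteq> 0"
    and p: "\<exists>\<^sub>F \<sigma> in at_right \<sigma>\<^sub>0. p < (\<sigma> - \<sigma>\<^sub>0) * cmod (A (Complex \<sigma> t\<^sub>0))"
    and q: "\<forall>\<^sub>F \<sigma> in at_right \<sigma>\<^sub>0. q < (\<sigma> - \<sigma>\<^sub>0) * Re (A (of_real \<sigma>))"
    and C: "C < p + q"
    and M: "1 \<le> M"
  shows "emeasure lebesgue ({x\<in>{1..}. \<Delta> x > C * x powr \<sigma>\<^sub>0} \<inter> {M..}) > 0"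
proof (rule ccontr)
  define X where "X = {x\<in>{1..}. \<Delta> x > C * x powr \<sigma>\<^sub>0} \<inter> {M..}"
  assume "\<not> emeasure lebesgue ({x\<in>{1..}. \<Delta> x > C * x powr \<sigma>\<^sub>0} \<inter> {M..}) > 0"
  then have X_null: "emeasure lebesgue X = 0"
    by (simp add: X_def)
  define N where "N = restrict_space lborel {1 :: real..}"
  have space_N: "space N = {1..}"
    by (simp add: N_def space_restrict_space)
  have [measurable]: "(\<lambda>x. x) \<in> borel_measurable N"
    unfolding N_def by (intro measurable_restrict_space1) simp
  obtain k where U: "open U" "A nicely_meromorphic_on U" "{s. Re s > k} \<subseteq> U"
    and mellin_int: "\<And>s. Re s > k \<Longrightarrow> set_integrable lborel {1..}
          (\<lambda>x. complex_of_real (\<Delta> x) * complex_of_real x powr (- s - 1))"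
    and A_eq: "\<And>s. Re s > k \<Longrightarrow> A s =
          (LINT x:{1..}|lborel. complex_of_real (\<Delta> x) * complex_of_real x powr (- s - 1))"
    using mellin unfolding mellin_continuation_def by blast
  have kernel: "complex_of_real (\<Delta> x) * complex_of_real x powr (- s - 1)
      = of_real (\<Delta> x / x) * exp (- (s * of_real (ln x)))" if "x \<in> space N" for x s
    using that by (simp add: space_N mellin_kernel)
  have D_int: "integrable N (\<lambda>x. of_real (\<Delta> x / x) * exp (- (s * of_real (ln x))) :: complex)"
    if "Re s > k" for s
  proof -
    have "integrable N (\<lambda>x. complex_of_real (\<Delta> x) * complex_of_real x powr (- s - 1))"
      using mellin_int[OF that] by (simp add: set_integrable_def N_def integrable_restrict_space)
    also have "?this \<longleftrightarrow> ?thesis"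
      by (intro Bochner_Integration.integrable_cong refl kernel)
    finally show ?thesis .
  qed
  have real_kernel: "complex_of_real (\<Delta> x / x) * exp (- (of_real \<sigma> * of_real (ln x)))
      = of_real (\<Delta> x / x * exp (- (\<sigma> * ln x)))" for x \<sigma>
    by (simp flip: exp_of_real)
  have D_int_real: "integrable N (\<lambda>x. \<Delta> x / x * exp (- (\<sigma> * ln x)))" if "\<sigma> > k" for \<sigma>
    using D_int[of "of_real \<sigma>"] that unfolding real_kernel complex_of_real_integrable_eq by simp
  have [measurable]: "\<Delta> \<in> borel_measurable N"
  proof -
    \<comment> \<open>Measurability of \<open>\<Delta>\<close> is recovered from an integrable
      weighted version, at a point \<open>k + 1\<close> of convergence, by multiplying the weight
      away.\<close>
    have "(\<lambda>x. \<Delta> x / x * exp (- ((k + 1) * ln x)) * (x * exp ((k + 1) * ln x))) \<in> borel_measurable N"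
      using borel_measurable_integrable[OF D_int_real[of "k + 1"]] by measurable
    also have "?this \<longleftrightarrow> ?thesis"
      by (intro measurable_cong) (auto simp: space_N exp_minus)
    finally show ?thesis .
  qed
  \<comment> \<open>The prefixes \<open>D\<close> and \<open>P\<close> mark the transforms of
    \<open>\<Delta>\<close> and of the power; the unprefixed \<open>F\<close> and
    \<open>conv\<close> belong to their combination \<open>f\<close>.\<close>
  define f where "f = (\<lambda>x. (C * x powr \<sigma>\<^sub>0 - \<Delta> x) / x)"
  interpret D: laplace_integral N ln "\<lambda>x. \<Delta> x / x"
    by unfold_locales (auto simp: space_N)
  interpret P: laplace_integral N ln "\<lambda>x. x powr \<sigma>\<^sub>0 / x"
    by unfold_locales (auto simp: space_N)
  interpret laplace_integral N ln f
    by unfold_locales (auto simp: space_N f_def)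
  have D_conv: "D.conv \<sigma>" if "k < \<sigma>" for \<sigma>
    unfolding D.conv_def using D_int_real[OF that] .
  have D_F: "D.F s = A s" if "k < Re s" for s :: complex
  proof -
    have "A s = (\<integral>x. complex_of_real (\<Delta> x) * complex_of_real x powr (- s - 1) \<partial>N)"
      unfolding A_eq[OF that] by (simp add: set_lebesgue_integral_def N_def integral_restrict_space)
    also have "\<dots> = D.F s"
      unfolding D.F_def by (intro Bochner_Integration.integral_cong refl kernel)
    finally show ?thesis
      by simp
  qed
  have P_powr: "x powr \<sigma>\<^sub>0 / x * exp (- (\<sigma> * ln x)) = x powr (\<sigma>\<^sub>0 - \<sigma> - 1)" if "x \<in> space N" for x \<sigma>
    using that by (simp add: space_N powr_diff) (simp add: powr_def exp_minus field_simps)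
  have P_conv: "P.conv \<sigma>" if "\<sigma>\<^sub>0 < \<sigma>" for \<sigma>
  proof -
    have "integrable N (\<lambda>x. x powr (\<sigma>\<^sub>0 - \<sigma> - 1))"
      unfolding N_def using that by (intro integrable_powr_to_inf) simp
    also have "?this \<longleftrightarrow> ?thesis"
      unfolding P.conv_def by (intro Bochner_Integration.integrable_cong refl P_powr[symmetric])
    finally show ?thesis .
  qed
  have P_F_real: "P.F (of_real \<sigma>) = 1 / (of_real \<sigma> - of_real \<sigma>\<^sub>0)" if "\<sigma>\<^sub>0 < \<sigma>" for \<sigma>
  proof -
    have "(\<integral>x. x powr \<sigma>\<^sub>0 / x * exp (- (\<sigma> * ln x)) \<partial>N) = (\<integral>x. x powr (\<sigma>\<^sub>0 - \<sigma> - 1) \<partial>N)"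
      by (intro Bochner_Integration.integral_cong P_powr refl)
    also have "\<dots> = 1 / (\<sigma> - \<sigma>\<^sub>0)"
      using integral_powr_to_inf[of "\<sigma>\<^sub>0 - \<sigma> - 1"] that by (simp add: N_def field_simps)
    finally show ?thesis
      using P.F_of_real[OF P_conv[OF that]] by simp
  qed
  have P_F: "P.F s = 1 / (s - of_real \<sigma>\<^sub>0)" if s: "\<sigma>\<^sub>0 < Re s" for s :: complex
  proof -
    \<comment> \<open>Only the real integral is computed; the identity theorem carries the formula
      to the half-plane.\<close>
    have "P.F s - 1 / (s - of_real \<sigma>\<^sub>0) = 0"
    proof (rule analytic_continuation[of "\<lambda>s. P.F s - 1 / (s - of_real \<sigma>\<^sub>0)" "{s. \<sigma>\<^sub>0 < Re s}"
          "complex_of_real ` {\<sigma>\<^sub>0<..}" "of_real (\<sigma>\<^sub>0 + 1)"])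
      show "(\<lambda>s. P.F s - 1 / (s - of_real \<sigma>\<^sub>0)) holomorphic_on {s. \<sigma>\<^sub>0 < Re s}"
        by (intro holomorphic_on_diff P.F_holomorphic P_conv holomorphic_intros) auto
      show "open {s. \<sigma>\<^sub>0 < Re s}" "connected {s. \<sigma>\<^sub>0 < Re s}"
        by (simp_all add: open_halfspace_Re_gt convex_connected convex_halfspace_Re_gt)
      show "complex_of_real (\<sigma>\<^sub>0 + 1) islimpt complex_of_real ` {\<sigma>\<^sub>0<..}"
        unfolding islimpt_approachable
      proof safe
        fix e :: real assume "0 < e"
        then show "\<exists>x'\<in>complex_of_real ` {\<sigma>\<^sub>0<..}. x' \<noteq> of_real (\<sigma>\<^sub>0 + 1) \<and> dist x' (of_real (\<sigma>\<^sub>0 + 1)) < e"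
          by (intro bexI[of _ "of_real (\<sigma>\<^sub>0 + 1 + e / 2)"] imageI)
             (auto simp: dist_norm simp del: of_real_add simp flip: of_real_diff)
      qed
    qed (use s P_F_real in auto)
    then show ?thesis
      by simp
  qed
  define c where "c = max k \<sigma>\<^sub>0 + 1"
  have f_split: "f x = C * (x powr \<sigma>\<^sub>0 / x) - \<Delta> x / x" for x
    by (simp add: f_def diff_divide_distrib)
  have "integrable N (\<lambda>x. C * (x powr \<sigma>\<^sub>0 / x * exp (- (c * ln x))) - \<Delta> x / x * exp (- (c * ln x)))"
    using P_conv[of c] D_conv[of c] unfolding P.conv_def D.conv_def
    by (intro Bochner_Integration.integrable_diff integrable_mult_right) (auto simp: c_def)
  then have conv_c: "conv c"
    by (simp add: conv_def f_split left_diff_distrib mult.assoc)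
  have F_eq: "F s = C / (s - of_real \<sigma>\<^sub>0) - A s" if s: "max k \<sigma>\<^sub>0 < Re s" for s :: complex
  proof -
    have "F s = (\<integral>x. complex_of_real C * (complex_of_real (x powr \<sigma>\<^sub>0 / x) * exp (- (s * complex_of_real (ln x))))
                   - complex_of_real (\<Delta> x / x) * exp (- (s * complex_of_real (ln x))) \<partial>N)"
      unfolding F_def f_split by (simp only: of_real_diff of_real_mult left_diff_distrib mult.assoc)
    also have "\<dots> = complex_of_real C * P.F s - D.F s"
    proof -
      have "integrable N (\<lambda>x. complex_of_real (x powr \<sigma>\<^sub>0 / x) * exp (- (s * of_real (ln x))))"
        using s by (intro P.integrable_F[OF P_conv order_refl]) simp
      then have "integrable N (\<lambda>x. of_real C * (complex_of_real (x powr \<sigma>\<^sub>0 / x) * exp (- (s * of_real (ln x)))))"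
        by (rule integrable_mult_right)
      moreover have "integrable N (\<lambda>x. complex_of_real (\<Delta> x / x) * exp (- (s * of_real (ln x))))"
        using s by (intro D.integrable_F[OF D_conv order_refl]) simp
      ultimately show ?thesis
        unfolding P.F_def D.F_def
        by (simp only: Bochner_Integration.integral_diff integral_mult_right_zero)
    qed
    finally show ?thesis
      using P_F[of s] D_F[of s] s by simp
  qed
  \<comment> \<open>A non-measurable set would have \<open>emeasure\<close> 0 by default, so
    \<open>X_null\<close> makes \<open>X\<close> a null set only once \<open>X\<close> is known to
    be measurable.\<close>
  have X_meas: "X \<in> sets lborel"
  proof -
    have "X = {x \<in> space N. \<Delta> x > C * x powr \<sigma>\<^sub>0 \<and> M \<le> x}"
      by (auto simp: X_def space_N)
    also have "\<dots> \<in> sets N"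
      by measurable
    finally show ?thesis
      by (simp add: N_def sets_restrict_space_iff)
  qed
  have "AE x in lborel. x \<notin> X"
    using X_null X_meas by (intro AE_not_in) (auto simp: null_sets_def)
  then have nonneg: "AE x in N. ln M < ln x \<longrightarrow> 0 \<le> f x"
    unfolding N_def using M
    by (subst AE_restrict_space_iff) (auto simp: X_def f_def elim!: eventually_mono)
  let ?H = "\<lambda>s :: complex. C / (s - of_real \<sigma>\<^sub>0) - A s"
  \<comment> \<open>Cutting \<open>V\<close> at \<open>Re s = \<sigma>\<^sub>0\<close> keeps the
    pole of \<open>C / (s - \<sigma>\<^sub>0)\<close> out.\<close>
  have V': "open (V \<inter> {s. \<sigma>\<^sub>0 < Re s})"
    using V(1) by (intro open_Int open_halfspace_Re_gt)
  have V'_line: "of_real \<sigma> \<in> V \<inter> {s. \<sigma>\<^sub>0 < Re s}" if "\<sigma>\<^sub>0 < \<sigma>" for \<sigma>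
    using V(2) that by auto
  have H_hol: "?H holomorphic_on V \<inter> {s. \<sigma>\<^sub>0 < Re s}"
    by (intro holomorphic_on_diff holomorphic_on_subset[OF V(3)] holomorphic_intros) auto
  have H_eq: "?H (of_real \<sigma>) = F (of_real \<sigma>)" if "c < \<sigma>" for \<sigma>
  proof -
    have "max k \<sigma>\<^sub>0 < Re (of_real \<sigma>)"
      using that unfolding c_def by simp linarith
    then show ?thesis
      by (rule F_eq[symmetric])
  qed
  note landau = landau_eventually_nonneg[OF nonneg conv_c V' V'_line H_hol H_eq]
  obtain B where B: "\<And>s. \<sigma>\<^sub>0 < Re s \<Longrightarrow> norm (F s) \<le> Re (F (of_real (Re s))) + B"
    using landau(2) by auto
  have F_hol: "F holomorphic_on {s. \<sigma>\<^sub>0 < Re s}"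
    by (intro F_holomorphic landau(1))
  \<comment> \<open>The identity spreads from the half-plane of convergence through the connected
    set \<open>U \<inter> {s. \<sigma>\<^sub>0 < Re s}\<close>, so the values of \<open>A\<close>
    near \<open>\<sigma>\<^sub>0 + i t\<^sub>0\<close> belong to the same branch.\<close>
  have A_cont: "A s = C / (s - of_real \<sigma>\<^sub>0) - F s" if "s \<in> U" "\<sigma>\<^sub>0 < Re s" for s :: complex
  proof (rule nicely_meromorphic_eq_holomorphic[where A = A and z = s
        and Q = "\<lambda>s :: complex. C / (s - of_real \<sigma>\<^sub>0) - F s" and S = "U \<inter> {s. \<sigma>\<^sub>0 < Re s}"
        and T = "{s. max k \<sigma>\<^sub>0 < Re s}"])
    show "A nicely_meromorphic_on U \<inter> {s. \<sigma>\<^sub>0 < Re s}"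
      using U(2) by (rule nicely_meromorphic_on_subset) auto
    show "(\<lambda>s :: complex. C / (s - of_real \<sigma>\<^sub>0) - F s) holomorphic_on U \<inter> {s. \<sigma>\<^sub>0 < Re s}"
      by (intro holomorphic_on_diff holomorphic_on_subset[OF F_hol] holomorphic_intros) auto
    show "open (U \<inter> {s. \<sigma>\<^sub>0 < Re s})"
      using U(1) by (intro open_Int open_halfspace_Re_gt)
    show "{s. max k \<sigma>\<^sub>0 < Re s} \<noteq> {}"
      using Re_complex_of_real[of "max k \<sigma>\<^sub>0 + 1"] by (auto intro!: exI[of _ "of_real (max k \<sigma>\<^sub>0 + 1)"])
    show "open {s. max k \<sigma>\<^sub>0 < Re s}"
      by (rule open_halfspace_Re_gt)
  qed (use U_right U(3) F_eq that in auto)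
  \<comment> \<open>On the line through \<open>t\<^sub>0\<close> the distance to
    \<open>\<sigma>\<^sub>0\<close> is at least \<open>\<bar>t\<^sub>0\<bar>\<close>, so the polar
    term is bounded there. After multiplication by \<open>\<sigma> - \<sigma>\<^sub>0\<close> all of
    \<open>B'\<close> drops below the gap \<open>p + q - C\<close>.\<close>
  define B' where "B' = B + \<bar>C\<bar> / \<bar>t\<^sub>0\<bar>"
  have "eventually (\<lambda>\<sigma>. \<sigma>\<^sub>0 < \<sigma>) (at_right \<sigma>\<^sub>0)"
    by (rule eventually_at_right_less)
  moreover have "((\<lambda>\<sigma>. (\<sigma> - \<sigma>\<^sub>0) * B') \<longlongrightarrow> (\<sigma>\<^sub>0 - \<sigma>\<^sub>0) * B') (at_right \<sigma>\<^sub>0)"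
    by (intro tendsto_intros)
  then have "eventually (\<lambda>\<sigma>. (\<sigma> - \<sigma>\<^sub>0) * B' < p + q - C) (at_right \<sigma>\<^sub>0)"
    by (rule order_tendstoD) (use C in simp)
  ultimately have "eventually (\<lambda>\<sigma>. (\<sigma> - \<sigma>\<^sub>0) * cmod (A (Complex \<sigma> t\<^sub>0)) \<le> p) (at_right \<sigma>\<^sub>0)"
    using q U_t0
  proof eventually_elim
    case (elim \<sigma>)
    let ?s = "Complex \<sigma> t\<^sub>0"
    have "A (of_real \<sigma>) = of_real (C / (\<sigma> - \<sigma>\<^sub>0)) - F (of_real \<sigma>)"
      using A_cont[of "of_real \<sigma>"] elim(1) U_half_line by simp
    then have "Re (F (of_real \<sigma>)) = C / (\<sigma> - \<sigma>\<^sub>0) - Re (A (of_real \<sigma>))"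
      by simp
    moreover have "cmod (A ?s) \<le> cmod (C / (?s - of_real \<sigma>\<^sub>0)) + cmod (F ?s)"
      using A_cont[of ?s] elim norm_triangle_ineq4 by simp
    moreover have "cmod (C / (?s - of_real \<sigma>\<^sub>0)) \<le> \<bar>C\<bar> / \<bar>t\<^sub>0\<bar>"
      using abs_Im_le_cmod[of "?s - of_real \<sigma>\<^sub>0"] t0
      by (auto simp: norm_divide intro!: divide_left_mono mult_pos_pos)
    moreover have "cmod (F ?s) \<le> Re (F (of_real \<sigma>)) + B"
      using B[of ?s] elim(1) by simp
    ultimately have "cmod (A ?s) \<le> C / (\<sigma> - \<sigma>\<^sub>0) - Re (A (of_real \<sigma>)) + B'"
      by (simp add: B'_def)
    then have "(\<sigma> - \<sigma>\<^sub>0) * cmod (A ?s) \<le> (\<sigma> - \<sigma>\<^sub>0) * (C / (\<sigma> - \<sigma>\<^sub>0) - Re (A (of_real \<sigma>)) + B')"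
      using elim(1) by (intro mult_left_mono) auto
    moreover have "(\<sigma> - \<sigma>\<^sub>0) * (C / (\<sigma> - \<sigma>\<^sub>0)) = C"
      using elim(1) by simp
    ultimately have "(\<sigma> - \<sigma>\<^sub>0) * cmod (A ?s)
        \<le> C - (\<sigma> - \<sigma>\<^sub>0) * Re (A (of_real \<sigma>)) + (\<sigma> - \<sigma>\<^sub>0) * B'"
      by (simp only: distrib_left right_diff_distrib)
    then show ?case
      using elim by linarith
  qed
  then show False
    using p by (simp add: frequently_def not_less)
qed

section \<open>Change of sign, and limits from frequent bounds\<close>

lemma mellin_continuation_uminus:
  assumes "mellin_continuation f A U"
  shows "mellin_continuation (\<lambda>x. - f x) (\<lambda>s. - A s) U"
  using assms unfolding mellin_continuation_def
  by (auto simp: set_lebesgue_integral_def set_integrable_def intro!: nicely_meromorphic_on_uminus)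

lemma frequently_at_top_of_emeasure_pos:
  assumes "\<And>M. 1 < M \<Longrightarrow> emeasure lebesgue ({x\<in>{1..}. P x} \<inter> {M :: real..}) > 0"
  shows "\<exists>\<^sub>F x in at_top. P x"
proof (rule ccontr)
  assume "\<not> (\<exists>\<^sub>F x in at_top. P x)"
  then obtain m where m: "\<And>x. m \<le> x \<Longrightarrow> \<not> P x"
    by (auto simp: frequently_def eventually_at_top_linorder)
  \<comment> \<open>The maximum with 2 meets the condition \<open>1 < M\<close>.\<close>
  then have "{x\<in>{1..}. P x} \<inter> {max m 2..} = {}"
    by auto
  then show False
    using assms[of "max m 2"] by (simp add: less_max_iff_disj)
qed

lemma Limsup_frequently_ge:
  fixes f :: "'a \<Rightarrow> 'b :: complete_linorder"
  assumes "\<exists>\<^sub>F x in G. c \<le> f x"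
  shows "c \<le> Limsup G f"
proof (rule ccontr)
  assume "\<not> c \<le> Limsup G f"
  then have "eventually (\<lambda>x. f x < c) G"
    by (intro Limsup_lessD) simp
  then show False
    using assms by (simp add: frequently_def not_le)
qed

lemma Liminf_frequently_le:
  fixes f :: "'a \<Rightarrow> 'b :: complete_linorder"
  assumes "\<exists>\<^sub>F x in G. f x \<le> c"
  shows "Liminf G f \<le> c"
proof (rule ccontr)
  assume "\<not> Liminf G f \<le> c"
  then have "eventually (\<lambda>x. c < f x) G"
    by (intro less_LiminfD) simp
  then show False
    using assms by (simp add: frequently_def not_le)
qed

section \<open>Both signs and the oscillation\<close>

theorem theorem3p2:
  fixes a :: "nat \<Rightarrow> real" and D A :: "complex \<Rightarrow> complex" and U :: "complex set"
    and T\<^sub>0 \<sigma>\<^sub>1 \<sigma>\<^sub>2 \<sigma>\<^sub>0 t\<^sub>0 lam l\<^sub>s l\<^sub>i :: real and \<Delta> :: "real \<Rightarrow> real"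
  assumes Delta: "\<Delta> = error_term a D T\<^sub>0 \<sigma>\<^sub>1"
    and setting: "dirichlet_setting a D T\<^sub>0 \<sigma>\<^sub>1 \<sigma>\<^sub>2"
    and mellin: "mellin_continuation \<Delta> A U"
    and U_right: "connected (U \<inter> {s. Re s > \<sigma>\<^sub>0})"
    and U_half_line: "\<And>\<sigma>. \<sigma> > \<sigma>\<^sub>0 \<Longrightarrow> complex_of_real \<sigma> \<in> U"
    and U_t0: "\<forall>\<^sub>F \<sigma> in at_right \<sigma>\<^sub>0. Complex \<sigma> t\<^sub>0 \<in> U"
    and i: "t\<^sub>0 \<noteq> 0"
      "Limsup (at_right \<sigma>\<^sub>0) (\<lambda>\<sigma>. ereal ((\<sigma> - \<sigma>\<^sub>0) * cmod (A (Complex \<sigma> t\<^sub>0)))) = ereal lam"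
      "lam > 0"
    and ii: "Limsup (at_right \<sigma>\<^sub>0) (\<lambda>\<sigma>. ereal ((\<sigma> - \<sigma>\<^sub>0) * Re (A (complex_of_real \<sigma>)))) = ereal l\<^sub>s"
      "Liminf (at_right \<sigma>\<^sub>0) (\<lambda>\<sigma>. ereal ((\<sigma> - \<sigma>\<^sub>0) * Re (A (complex_of_real \<sigma>)))) = ereal l\<^sub>i"
    and iii: "l\<^sub>i + lam > 0" "l\<^sub>s - lam < 0"
    and iv: "\<exists>V. open V \<and> connected V \<and> complex_of_real ` {\<sigma>\<^sub>0<..} \<subseteq> V \<and> A holomorphic_on V"
  shows "(\<forall>\<epsilon>. 0 < \<epsilon> \<and> \<epsilon> < min (lam + l\<^sub>i) (lam - l\<^sub>s) \<longrightarrow>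
            (\<forall>M>1.
               emeasure lebesgue ({x\<in>{1..}. \<Delta> x > (l\<^sub>i + lam - \<epsilon>) * x powr \<sigma>\<^sub>0} \<inter> {M..}) > 0 \<and>
               emeasure lebesgue ({x\<in>{1..}. \<Delta> x < (l\<^sub>s - lam + \<epsilon>) * x powr \<sigma>\<^sub>0} \<inter> {M..}) > 0))
         \<and> Omega_pm \<Delta> (\<lambda>x. x powr \<sigma>\<^sub>0)"
proof -
  obtain V where V: "open V" "complex_of_real ` {\<sigma>\<^sub>0<..} \<subseteq> V" "A holomorphic_on V"
    using iv by blast
  have p: "\<exists>\<^sub>F \<sigma> in at_right \<sigma>\<^sub>0. p < (\<sigma> - \<sigma>\<^sub>0) * cmod (A (Complex \<sigma> t\<^sub>0))" if "p < lam" for p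
  proof (rule ccontr)
    assume "\<not> ?thesis"
    then have "eventually (\<lambda>\<sigma>. ereal ((\<sigma> - \<sigma>\<^sub>0) * cmod (A (Complex \<sigma> t\<^sub>0))) \<le> ereal p) (at_right \<sigma>\<^sub>0)"
      by (simp add: frequently_def not_less)
    from Limsup_bounded[OF this] show False
      using i(2) that by simp
  qed
  have above: "emeasure lebesgue ({x\<in>{1..}. \<Delta> x > (l\<^sub>i + lam - \<epsilon>) * x powr \<sigma>\<^sub>0} \<inter> {M..}) > 0"
    if "0 < \<epsilon>" "1 < M" for \<epsilon> M
  \<comment> \<open>\<open>p\<close> and \<open>q\<close> each give up
    \<open>\<epsilon> / 3\<close>, which stays strictly below the \<open>\<epsilon>\<close> conceded
    in the threshold.\<close>
  proof (rule emeasure_above_power_pos[OF mellin U_right U_half_line U_t0 V i(1) p])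
    show "lam - \<epsilon> / 3 < lam" "l\<^sub>i + lam - \<epsilon> < (lam - \<epsilon> / 3) + (l\<^sub>i - \<epsilon> / 3)" "1 \<le> M"
      using that by auto
    have "ereal (l\<^sub>i - \<epsilon> / 3) < Liminf (at_right \<sigma>\<^sub>0) (\<lambda>\<sigma>. ereal ((\<sigma> - \<sigma>\<^sub>0) * Re (A (complex_of_real \<sigma>))))"
      using ii(2) that by simp
    from less_LiminfD[OF this]
    show "\<forall>\<^sub>F \<sigma> in at_right \<sigma>\<^sub>0. l\<^sub>i - \<epsilon> / 3 < (\<sigma> - \<sigma>\<^sub>0) * Re (A (of_real \<sigma>))"
      by simp
  qed
  have "emeasure lebesgue ({x\<in>{1..}. - \<Delta> x > (lam - l\<^sub>s - \<epsilon>) * x powr \<sigma>\<^sub>0} \<inter> {M..}) > 0"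
    if "0 < \<epsilon>" "1 < M" for \<epsilon> M
  \<comment> \<open>For \<open>- \<Delta>\<close> and \<open>- A\<close> the modulus keeps
    \<open>lam\<close>, while the lower limit on the real axis becomes
    \<open>- l\<^sub>s\<close>.\<close>
  proof (rule emeasure_above_power_pos[OF mellin_continuation_uminus[OF mellin] U_right U_half_line U_t0 V(1,2) _ i(1)])
    show "(\<lambda>s. - A s) holomorphic_on V"
      using V(3) by (rule holomorphic_on_minus)
    show "\<exists>\<^sub>F \<sigma> in at_right \<sigma>\<^sub>0. lam - \<epsilon> / 3 < (\<sigma> - \<sigma>\<^sub>0) * cmod (- A (Complex \<sigma> t\<^sub>0))"
      using p[of "lam - \<epsilon> / 3"] that by simp
    show "lam - l\<^sub>s - \<epsilon> < (lam - \<epsilon> / 3) + (- l\<^sub>s - \<epsilon> / 3)" "1 \<le> M"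
      using that by auto
    have "Limsup (at_right \<sigma>\<^sub>0) (\<lambda>\<sigma>. ereal ((\<sigma> - \<sigma>\<^sub>0) * Re (A (complex_of_real \<sigma>)))) < ereal (l\<^sub>s + \<epsilon> / 3)"
      using ii(1) that by simp
    from Limsup_lessD[OF this]
    show "\<forall>\<^sub>F \<sigma> in at_right \<sigma>\<^sub>0. - l\<^sub>s - \<epsilon> / 3 < (\<sigma> - \<sigma>\<^sub>0) * Re (- A (of_real \<sigma>))"
      by eventually_elim simp
  qed
  moreover have "- y > (lam - l\<^sub>s - \<epsilon>) * z \<longleftrightarrow> y < (l\<^sub>s - lam + \<epsilon>) * z" for y z \<epsilon>
    by (auto simp: algebra_simps)
  ultimately have below: "emeasure lebesgue ({x\<in>{1..}. \<Delta> x < (l\<^sub>s - lam + \<epsilon>) * x powr \<sigma>\<^sub>0} \<inter> {M..}) > 0"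
    if "0 < \<epsilon>" "1 < M" for \<epsilon> M
    using that by simp
  \<comment> \<open>Halving the gaps given by \<open>iii\<close> leaves the thresholds
    \<open>e > 0\<close> and \<open>- f < 0\<close>.\<close>
  define e f where "e = (lam + l\<^sub>i) / 2" and "f = (lam - l\<^sub>s) / 2"
  have ef: "0 < e" "0 < f" "l\<^sub>i + lam - e = e" "l\<^sub>s - lam + f = - f"
    using iii by (auto simp: e_def f_def field_simps)
  have pos: "eventually (\<lambda>x :: real. 0 < x powr \<sigma>\<^sub>0) at_top"
    using eventually_gt_at_top[of 0] by eventually_elim simp
  have "\<exists>\<^sub>F x in at_top. ereal e \<le> ereal (\<Delta> x / x powr \<sigma>\<^sub>0)"
    using frequently_eventually_frequently[OF frequently_at_top_of_emeasure_pos[OF above[OF ef(1)]] pos]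
    unfolding ef(3) by (rule frequently_elim1) (auto simp: field_simps)
  from Limsup_frequently_ge[OF this]
  have "Limsup at_top (\<lambda>x. ereal (\<Delta> x / x powr \<sigma>\<^sub>0)) > 0"
    using ef(1) by (metis ereal_less(2) less_le_trans)
  moreover have "\<exists>\<^sub>F x in at_top. ereal (\<Delta> x / x powr \<sigma>\<^sub>0) \<le> ereal (- f)"
    using frequently_eventually_frequently[OF frequently_at_top_of_emeasure_pos[OF below[OF ef(2)]] pos]
    unfolding ef(4) by (rule frequently_elim1) (auto simp: field_simps)
  from Liminf_frequently_le[OF this]
  have "Liminf at_top (\<lambda>x. ereal (\<Delta> x / x powr \<sigma>\<^sub>0)) < 0"
    by (rule le_less_trans) (use ef(2) in simp)
  ultimately show ?thesis
    using above below by (simp add: Omega_pm_def)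
qed

end
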